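(* Let $V$ be a finite-dimensional real inner product space, let $g\colon V\to(-\infty,+\infty]$ be a proper convex lower semicontinuous function, and let $F\colon \operatorname{dom} g\to V$ be monotone, i.e. $\langle F(u)-F(v),u-v\rangle\ge 0$ for all $u,v\in\operatorname{dom} g$, and $L$-Lipschitz for some $L>0$. Assume that the solution set $S$ of the variational inequality $$\text{find } z^*\in V \text{ such that } \langle F(z^* ),z-z^*\rangle+g(z)-g(z^* )\ge 0\quad \forall z\in V$$ is nonempty. Let $\varphi=\frac{\sqrt5+1}{2}$, let $z^1\in\operatorname{dom} g$ and $\bar z^0\in V$ be arbitrary, and let $\lambda\in\left(0,\frac{\varphi}{2L}\right]$. Then the sequences $(z^k)$ and $(\bar z^k)$ generated for $k\ge 1$ by $$\bar z^k=\frac{(\varphi-1)z^k+\bar z^{k-1}}{\varphi},\qquad z^{k+1}=\operatorname{prox}_{\lambda g}\bigl(\bar z^k-\lambda F(z^k)\bigr)$$ converge to a solution of this variational inequality.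
   Context: $\|\cdot\|=\sqrt{\langle\cdot,\cdot\rangle}$ is the norm of $V$; $\operatorname{dom} g=\{x\in V: g(x)<+\infty\}$; for $\lambda>0$, $\operatorname{prox}_{\lambda g}(z)=\operatorname{argmin}_{x\in V}\{\lambda g(x)+\frac12\|x-z\|^2\}$. Solutions $z^*$ of the variational inequality are understood to lie in $\operatorname{dom} g$. *)

theory Defs
  imports "HOL-Analysis.Analysis"
begin

definition effective_domain :: "('a \<Rightarrow> ereal) \<Rightarrow> 'a set" where
  "effective_domain g = {x. g x < \<infinity>}"

definition proper_fun :: "('a \<Rightarrow> ereal) \<Rightarrow> bool" where
  "proper_fun g \<longleftrightarrow> (\<forall>x. g x \<noteq> -\<infinity>) \<and> effective_domain g \<noteq> {}"

(* Only meaningful for functions avoiding -\<infinity>, since \<infinity> + (-\<infinity>) = \<infinity> on ereal.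
   At t = 0 and t = 1 the convention 0 * \<infinity> = 0 makes the inequality trivial. *)
definition convex_fun :: "('a::real_vector \<Rightarrow> ereal) \<Rightarrow> bool" where
  "convex_fun g \<longleftrightarrow>
     (\<forall>x y. \<forall>t\<in>{0..1::real}.
        g ((1 - t) *\<^sub>R x + t *\<^sub>R y) \<le> ereal (1 - t) * g x + ereal t * g y)"

definition lower_semicontinuous :: "('a::topological_space \<Rightarrow> ereal) \<Rightarrow> bool" where
  "lower_semicontinuous g \<longleftrightarrow> (\<forall>x. g x \<le> Liminf (nhds x) g)"

(* arg_min selects some minimizer. For proper convex lower semicontinuous h on a
   finite-dimensional space the minimizer exists and is unique, so there this is
   the proximal point. *)
definition prox :: "('a::real_inner \<Rightarrow> ereal) \<Rightarrow> 'a \<Rightarrow> 'a" where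
  "prox h z = (ARG_MIN (\<lambda>x. h x + ereal (1/2 * (norm (x - z))\<^sup>2)) x. True)"

(* Membership in the effective domain is explicit: it rules out the ereal
   difference \<infinity> - \<infinity>, and F is only meaningful there. *)
definition VI_solutions :: "('a::real_inner \<Rightarrow> 'a) \<Rightarrow> ('a \<Rightarrow> ereal) \<Rightarrow> 'a set" where
  "VI_solutions F g =
     {zs \<in> effective_domain g. \<forall>z. ereal (F zs \<bullet> (z - zs)) + g z - g zs \<ge> 0}"

end

theory Submission
  imports Defs
begin

text \<open>
  Golden ratio algorithm. Adding the variational inequality of \<open>z (k+1)\<close>, tested at a solution
  \<open>zs\<close>, to that of \<open>z k\<close>, tested at \<open>z (k+1)\<close>, and using the identity
  \<open>phi\<^sup>2 = phi + 1\<close>, one obtains that the energy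
  \<open>(1 + phi) * (norm (zbar k - zs))\<^sup>2 + phi / 2 * (norm (z k - z (k-1)))\<^sup>2\<close>
  drops by at least \<open>phi * (norm (z k - zbar k))\<^sup>2\<close> in each step. Hence \<open>zbar\<close> is bounded,
  \<open>z k - zbar k\<close> vanishes in the limit, every cluster point is a solution, and the
  energy relative to a cluster point tends to zero.
\<close>

section \<open>Compactness in finite dimension\<close>

text \<open>The residual is orthogonal to each member of \<open>C\<close>, hence to its span, hence
  to itself. A zero vector in \<open>C\<close> does no harm, as its coefficient is 0 by the
  convention for division by 0.\<close>

lemma orthogonal_expansion:
  fixes C :: "'a::real_inner set"
  assumes "finite C" and span: "span C = UNIV" and orth: "pairwise orthogonal C"
  shows "x = (\<Sum>b\<in>C. (b \<bullet> x / (b \<bullet> b)) *\<^sub>R b)"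
proof -
  define y where "y = x - (\<Sum>b\<in>C. (b \<bullet> x / (b \<bullet> b)) *\<^sub>R b)"
  have "orthogonal y c" if c: "c \<in> C" for c
  proof -
    have "(\<Sum>b\<in>C. (b \<bullet> x / (b \<bullet> b)) * (b \<bullet> c)) = (\<Sum>b\<in>C. if b = c then c \<bullet> x else 0)"
      using orth c by (intro sum.cong) (auto simp: pairwise_def orthogonal_def)
    then show ?thesis
      using c \<open>finite C\<close>
      by (simp add: y_def orthogonal_def inner_diff_left inner_sum_left inner_commute[of c x])
  qed
  then have "orthogonal y v" if "v \<in> span C" for v
    using that by (rule orthogonal_to_span[rotated])
  then have "orthogonal y y" by (simp add: span)
  then show ?thesis by (simp add: y_def orthogonal_self)
qed

text \<open>Bolzano-Weierstrass on the reals, refining the subsequence once for each index.\<close>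

lemma bounded_family_convergent_subseq:
  fixes f :: "nat \<Rightarrow> 'b \<Rightarrow> real"
  assumes "finite C" and "\<And>b. b \<in> C \<Longrightarrow> bounded (range (\<lambda>n. f n b))"
  shows "\<exists>l r. strict_mono r \<and> (\<forall>b\<in>C. (\<lambda>n. f (r n) b) \<longlonglongrightarrow> l b)"
  using assms
proof (induction C rule: finite_induct)
  case empty
  have "strict_mono (\<lambda>n::nat. n)" by (simp add: strict_mono_def)
  then show ?case by auto
next
  case (insert c C)
  then obtain l r where r: "strict_mono r" and l: "\<forall>b\<in>C. (\<lambda>n. f (r n) b) \<longlonglongrightarrow> l b"
    by (metis insertCI)
  have "bounded (range (\<lambda>n. f (r n) c))"
    by (rule bounded_subset[OF insert.prems[of c]]) auto
  then obtain m s where s: "strict_mono s" and m: "((\<lambda>n. f (r n) c) \<circ> s) \<longlonglongrightarrow> m"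
    using bounded_imp_convergent_subsequence by blast
  have "(\<lambda>n. f ((r \<circ> s) n) b) \<longlonglongrightarrow> (l(c := m)) b" if "b \<in> insert c C" for b
  proof (cases "b = c")
    case True then show ?thesis using m by (simp add: o_def)
  next
    case False
    then have "((\<lambda>n. f (r n) b) \<circ> s) \<longlonglongrightarrow> l b"
      using that l s by (intro LIMSEQ_subseq_LIMSEQ) auto
    then show ?thesis using False by (simp add: o_def)
  qed
  then show ?case using strict_mono_o[OF r s] by blast
qed

text \<open>Finite dimension is a hypothesis here and not a type class, so compactness is
  transferred from the reals through the coordinates of an orthogonal spanning set.\<close>

lemma bounded_convergent_subseq_finite_span:
  fixes f :: "nat \<Rightarrow> 'a::real_inner"
  assumes "\<exists>B::'a set. finite B \<and> span B = UNIV" and "bounded (range f)"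
  shows "\<exists>l r. strict_mono r \<and> (\<lambda>n. f (r n)) \<longlonglongrightarrow> l"
proof -
  obtain C :: "'a set" where C: "finite C" "span C = UNIV" "pairwise orthogonal C"
    using assms(1) basis_orthogonal by metis
  obtain M where M: "\<And>n. norm (f n) \<le> M"
    using assms(2) by (auto simp: bounded_iff)
  have "bounded (range (\<lambda>n. b \<bullet> f n / (b \<bullet> b)))" for b
  proof -
    have "\<bar>b \<bullet> f n / (b \<bullet> b)\<bar> \<le> norm b * M / (b \<bullet> b)" for n
    proof -
      have "\<bar>b \<bullet> f n\<bar> \<le> norm b * M"
        using Cauchy_Schwarz_ineq2[of b "f n"] M[of n] by (meson mult_left_mono norm_ge_zero order_trans)
      then show ?thesis by (simp add: divide_right_mono)
    qed
    then show ?thesis by (auto simp: bounded_iff)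
  qed
  then obtain l r where r: "strict_mono r"
    and l: "\<forall>b\<in>C. (\<lambda>n. b \<bullet> f (r n) / (b \<bullet> b)) \<longlonglongrightarrow> l b"
    using bounded_family_convergent_subseq[OF C(1), of "\<lambda>n b. b \<bullet> f n / (b \<bullet> b)"] by blast
  have "(\<lambda>n. \<Sum>b\<in>C. (b \<bullet> f (r n) / (b \<bullet> b)) *\<^sub>R b) \<longlonglongrightarrow> (\<Sum>b\<in>C. l b *\<^sub>R b)"
    using l by (intro tendsto_intros) auto
  then have "(\<lambda>n. f (r n)) \<longlonglongrightarrow> (\<Sum>b\<in>C. l b *\<^sub>R b)"
    by (simp flip: orthogonal_expansion[OF C])
  with r show ?thesis by blast
qed

section \<open>Proper convex lower semicontinuous functions and their proximal points\<close>

locale proper_convex_lsc =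
  fixes g :: "'a::real_inner \<Rightarrow> ereal"
  assumes fin_dim: "\<exists>B::'a set. finite B \<and> span B = UNIV"
    and g_proper: "proper_fun g"
    and g_convex: "convex_fun g"
    and g_lsc: "lower_semicontinuous g"
begin

abbreviation D where "D \<equiv> effective_domain g"

text \<open>Real-valued form of \<open>g\<close>. It represents \<open>g\<close> on \<open>D\<close>
  only; where \<open>g\<close> is infinite it takes the default value 0.\<close>

definition G :: "'a \<Rightarrow> real" where "G x = real_of_ereal (g x)"

lemma g_eq_G: "x \<in> D \<Longrightarrow> g x = ereal (G x)"
  using g_proper unfolding G_def effective_domain_def proper_fun_def
  by (cases "g x") auto

lemma g_outside: "x \<notin> D \<Longrightarrow> g x = \<infinity>"
  by (auto simp: effective_domain_def)

lemma G_convex: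
  assumes "x \<in> D" "y \<in> D" "0 \<le> t" "t \<le> 1"
  shows "(1 - t) *\<^sub>R x + t *\<^sub>R y \<in> D"
    and "G ((1 - t) *\<^sub>R x + t *\<^sub>R y) \<le> (1 - t) * G x + t * G y"
proof -
  have le: "g ((1 - t) *\<^sub>R x + t *\<^sub>R y) \<le> ereal ((1 - t) * G x + t * G y)"
    using g_convex[unfolded convex_fun_def, rule_format, where x = x and y = y and t = t] assms
    by (simp add: g_eq_G)
  then show mem: "(1 - t) *\<^sub>R x + t *\<^sub>R y \<in> D"
    unfolding effective_domain_def by (auto intro: le_less_trans)
  show "G ((1 - t) *\<^sub>R x + t *\<^sub>R y) \<le> (1 - t) * G x + t * G y"
    using le g_eq_G[OF mem] by simp
qed

text \<open>Sequential closedness of the epigraph: the points \<open>(xs n, c n)\<close> lie in it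
  and tend to \<open>(x, C)\<close>. That the limit has finite value is part of the
  conclusion.\<close>

lemma G_lsc:
  assumes xs: "xs \<longlonglongrightarrow> x" and mem: "\<And>n. xs n \<in> D" and le: "\<And>n. G (xs n) \<le> c n" and c: "c \<longlonglongrightarrow> C"
  shows "x \<in> D" and "G x \<le> C"
proof -
  have g_le: "g x \<le> ereal C"
  proof (rule ccontr)
    assume "\<not> g x \<le> ereal C"
    \<comment> \<open>The separating level \<open>d\<close> is real even if \<open>g x\<close> is
      infinite. Semicontinuity keeps \<open>g\<close> above \<open>d\<close> near \<open>x\<close>,
      while \<open>c n\<close> falls below \<open>d\<close>.\<close>
    then obtain d where d: "ereal C < ereal d" "ereal d < g x"
      using ereal_dense2 by (metis not_le)
    have "ereal d < Liminf (nhds x) g"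
      using d(2) g_lsc unfolding lower_semicontinuous_def by (meson less_le_trans)
    then have "eventually (\<lambda>y. ereal d < g y) (nhds x)"
      by (rule less_LiminfD)
    then have "eventually (\<lambda>n. ereal d < g (xs n)) sequentially"
      using xs by (rule eventually_compose_filterlim)
    moreover have "eventually (\<lambda>n. c n < d) sequentially"
      using c d(1) by (auto intro: order_tendstoD)
    ultimately have "eventually (\<lambda>n. False) sequentially"
    proof eventually_elim
      case (elim n)
      then have "d < G (xs n)" using g_eq_G[OF mem[of n]] by simp
      then show False using elim le[of n] by simp
    qed
    then show False by simp
  qed
  then show "x \<in> D"
    unfolding effective_domain_def by (auto intro: le_less_trans)
  then show "G x \<le> C" using g_le g_eq_G by simp
qed

section \<open>Lower bounds for convex functions\<close>

text \<open>Otherwise values below every \<open>- real n\<close> occur in the ball, and by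
  compactness and semicontinuity a cluster point would have value below every bound.\<close>

lemma G_lower_bound_on_unit_ball: "\<exists>m. \<forall>x\<in>D. norm (x - x0) \<le> 1 \<longrightarrow> m \<le> G x"
proof (rule ccontr)
  assume "\<nexists>m. \<forall>x\<in>D. norm (x - x0) \<le> 1 \<longrightarrow> m \<le> G x"
  then have "\<forall>n::nat. \<exists>x\<in>D. norm (x - x0) \<le> 1 \<and> G x < - real n"
    by (meson not_le)
  then obtain xs where xs: "\<And>n. xs n \<in> D" "\<And>n. norm (xs n - x0) \<le> 1" "\<And>n. G (xs n) < - real n"
    by metis
  have "norm (xs n) \<le> norm x0 + 1" for n
    using xs(2)[of n] norm_triangle_sub[of "xs n" x0] by simp
  then have "bounded (range xs)" by (auto simp: bounded_iff)
  then obtain l r where r: "strict_mono r" and l: "(\<lambda>n. xs (r n)) \<longlonglongrightarrow> l"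
    using bounded_convergent_subseq_finite_span[OF fin_dim] by blast
  \<comment> \<open>Dropping the first \<open>N\<close> terms makes the bound hold along the whole
    sequence, because \<open>r (n + N)\<close> is at least \<open>n + N\<close>.\<close>
  have "G l \<le> - real N" for N
  proof (rule G_lsc(2))
    show "(\<lambda>n. xs (r (n + N))) \<longlonglongrightarrow> l" using l by (rule LIMSEQ_ignore_initial_segment)
    show "G (xs (r (n + N))) \<le> - real N" for n
      using xs(3)[of "r (n + N)"] seq_suble[OF r, of "n + N"] by linarith
  qed (auto intro: xs)
  moreover obtain N :: nat where "- G l < real N" using reals_Archimedean2 by blast
  ultimately show False by (metis minus_less_iff not_le)
qed

text \<open>By convexity, a steep fall of \<open>G\<close> far from \<open>x0\<close> would already
  show on the unit sphere around \<open>x0\<close>, where \<open>m\<close> bounds \<open>G\<close>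
  from below. This serves in place of an affine minorant.\<close>

lemma G_linear_lower_bound:
  obtains a b where "0 \<le> b" "\<And>x. x \<in> D \<Longrightarrow> - a - b * norm (x - w) \<le> G x"
proof -
  obtain x0 where x0: "x0 \<in> D" using g_proper by (auto simp: proper_fun_def)
  obtain m where m: "\<And>x. x \<in> D \<Longrightarrow> norm (x - x0) \<le> 1 \<Longrightarrow> m \<le> G x"
    using G_lower_bound_on_unit_ball by metis
  define c where "c = G x0 - m"
  have c: "0 \<le> c" using m[OF x0] by (simp add: c_def)
  have bound: "m - c * norm (x - x0) \<le> G x" if x: "x \<in> D" for x
  proof (cases "norm (x - x0) \<le> 1")
    case True
    then show ?thesis using m[OF x] c
      by (smt (verit) mult_nonneg_nonneg norm_ge_zero)
  next
    case False
    define r where "r = norm (x - x0)"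
    have r: "1 < r" using False by (simp add: r_def)
    \<comment> \<open>The point at distance 1 from \<open>x0\<close> on the segment from
      \<open>x0\<close> to \<open>x\<close>.\<close>
    define y where "y = (1 - 1 / r) *\<^sub>R x0 + (1 / r) *\<^sub>R x"
    have y: "y \<in> D" "G y \<le> (1 - 1 / r) * G x0 + (1 / r) * G x"
      unfolding y_def by (rule G_convex; use x0 x r in simp)+
    have "y - x0 = (1 / r) *\<^sub>R (x - x0)" by (simp add: y_def algebra_simps)
    then have "norm (y - x0) = 1" using r by (simp add: r_def[symmetric])
    then have "m \<le> (1 - 1 / r) * G x0 + (1 / r) * G x" using m y by fastforce
    then have "r * m \<le> r * ((1 - 1 / r) * G x0 + (1 / r) * G x)" using r by simp
    also have "\<dots> = (r - 1) * G x0 + G x" using r by (simp add: field_simps)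
    finally show ?thesis using c r by (simp add: c_def r_def[symmetric] algebra_simps)
  qed
  have "- (c * norm (w - x0) - m) - c * norm (x - w) \<le> G x" if "x \<in> D" for x
  proof -
    have "norm (x - x0) \<le> norm (x - w) + norm (w - x0)"
      using norm_triangle_ineq[of "x - w" "w - x0"] by simp
    then have "c * norm (x - x0) \<le> c * norm (x - w) + c * norm (w - x0)"
      using c by (metis distrib_left mult_left_mono)
    then show ?thesis using bound[OF that] by linarith
  qed
  then show ?thesis using c that by blast
qed

section \<open>Existence and optimality of proximal points\<close>

text \<open>Direct method: coercivity bounds a minimizing sequence, and semicontinuity makes its
  cluster point a minimizer.\<close>

lemma prox_objective_has_minimizer:
  fixes w :: 'a
  assumes lam: "0 < lam"
  shows "\<exists>p\<in>D. \<forall>x\<in>D. lam * G p + 1/2 * (norm (p - w))\<^sup>2 \<le> lam * G x + 1/2 * (norm (x - w))\<^sup>2"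
proof -
  define \<Phi> where "\<Phi> x = lam * G x + 1/2 * (norm (x - w))\<^sup>2" for x
  obtain a b where b: "0 \<le> b" and ab: "\<And>x. x \<in> D \<Longrightarrow> - a - b * norm (x - w) \<le> G x"
    using G_linear_lower_bound[where w = w] by blast
  \<comment> \<open>Completing the square: half of the quadratic term absorbs the linear term
    \<open>lam * b * norm (x - w)\<close> at the cost \<open>(lam * b)^2\<close>.\<close>
  define \<alpha> where "\<alpha> = lam * a + (lam * b)\<^sup>2"
  have coercive: "(norm (x - w))\<^sup>2 / 4 - \<alpha> \<le> \<Phi> x" if "x \<in> D" for x
  proof -
    have "lam * (- a - b * norm (x - w)) \<le> lam * G x"
      using ab[OF that] lam by simp
    moreover have "0 \<le> (norm (x - w) / 2 - lam * b)\<^sup>2" by simp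
    ultimately show ?thesis
      unfolding \<Phi>_def \<alpha>_def by (simp add: power2_eq_square algebra_simps)
  qed
  have ne: "D \<noteq> {}" using g_proper by (simp add: proper_fun_def)
  have "- \<alpha> \<le> \<Phi> x" if "x \<in> D" for x
    using coercive[OF that] zero_le_power2[of "norm (x - w)"] by linarith
  then have bdd: "bdd_below (\<Phi> ` D)" by (intro bdd_belowI2)
  define I where "I = Inf (\<Phi> ` D)"
  have I_le: "I \<le> \<Phi> x" if "x \<in> D" for x
    unfolding I_def using bdd that by (simp add: cInf_lower)
  have "\<exists>x\<in>D. \<Phi> x < I + 1 / real (Suc n)" for n
  proof -
    have "Inf (\<Phi> ` D) < I + 1 / real (Suc n)" by (simp add: I_def)
    then show ?thesis using ne bdd by (auto simp: cInf_less_iff)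
  qed
  then obtain xs where xs: "\<And>n. xs n \<in> D" "\<And>n. \<Phi> (xs n) < I + 1 / real (Suc n)"
    by metis
  have "norm (xs n) \<le> norm w + (1 + 4 * (I + 1 + \<alpha>))" for n
  proof -
    have "1 / real (Suc n) \<le> 1" by simp
    then have "(norm (xs n - w))\<^sup>2 \<le> 4 * (I + 1 + \<alpha>)"
      using coercive[OF xs(1)[of n]] xs(2)[of n] by argo
    \<comment> \<open>Yields s \<le> 1 + s^2 for \<open>s = norm (xs n - w)\<close>, which turns the
      bound on the square into one on the norm.\<close>
    moreover have "0 \<le> (norm (xs n - w) - 1)\<^sup>2 + (norm (xs n - w))\<^sup>2" by simp
    ultimately have "norm (xs n - w) \<le> 1 + 4 * (I + 1 + \<alpha>)"
      by (simp add: power2_eq_square algebra_simps)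
    then show ?thesis using norm_triangle_sub[of "xs n" w] by linarith
  qed
  then have "bounded (range xs)" by (auto simp: bounded_iff)
  then obtain l r where r: "strict_mono r" and l: "(\<lambda>n. xs (r n)) \<longlonglongrightarrow> l"
    using bounded_convergent_subseq_finite_span[OF fin_dim] by blast
  \<comment> \<open>Near-minimality solved for \<open>G\<close>; this bound converges, so
    \<open>G_lsc\<close> applies.\<close>
  define c where "c n = (I + 1 / real (Suc (r n)) - 1/2 * (norm (xs (r n) - w))\<^sup>2) / lam" for n
  have inv0: "(\<lambda>n. 1 / real (Suc (r n))) \<longlonglongrightarrow> 0"
    using LIMSEQ_subseq_LIMSEQ[OF lim_1_over_n[THEN LIMSEQ_Suc] r] by (simp add: o_def)
  have clim: "c \<longlonglongrightarrow> (I + 0 - 1/2 * (norm (l - w))\<^sup>2) / lam"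
    unfolding c_def by (intro tendsto_intros inv0 l) (use lam in simp)
  have cle: "G (xs (r n)) \<le> c n" for n
  proof -
    have "lam * G (xs (r n)) \<le> I + 1 / real (Suc (r n)) - 1/2 * (norm (xs (r n) - w))\<^sup>2"
      using xs(2)[of "r n"] unfolding \<Phi>_def by linarith
    then show ?thesis using lam unfolding c_def by (simp add: pos_le_divide_eq mult.commute)
  qed
  have "l \<in> D" "G l \<le> (I + 0 - 1/2 * (norm (l - w))\<^sup>2) / lam"
    using G_lsc[OF l xs(1) cle clim] by auto
  then have "\<Phi> l \<le> I" using lam unfolding \<Phi>_def by (simp add: field_simps)
  then show ?thesis using \<open>l \<in> D\<close> I_le unfolding \<Phi>_def by (meson order_trans)
qed

text \<open>\<open>ARG_MIN\<close> is meaningful only if a minimizer exists. The minimizer over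
  \<open>D\<close> is one over the whole space, because the objective is infinite outside
  \<open>D\<close>.\<close>

lemma prox_minimizes:
  fixes w :: 'a
  assumes lam: "0 < lam"
  defines "p \<equiv> prox (\<lambda>x. ereal lam * g x) w"
  shows "p \<in> D"
    and "x \<in> D \<Longrightarrow> lam * G p + 1/2 * (norm (p - w))\<^sup>2 \<le> lam * G x + 1/2 * (norm (x - w))\<^sup>2"
proof -
  define h where "h x = ereal lam * g x + ereal (1/2 * (norm (x - w))\<^sup>2)" for x
  have h_in: "h x = ereal (lam * G x + 1/2 * (norm (x - w))\<^sup>2)" if "x \<in> D" for x
    using that by (simp add: h_def g_eq_G)
  have h_out: "h x = \<infinity>" if "x \<notin> D" for x
    using that lam by (simp add: h_def g_outside)
  obtain q where q: "q \<in> D"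
    and qmin: "\<And>x. x \<in> D \<Longrightarrow> lam * G q + 1/2 * (norm (q - w))\<^sup>2 \<le> lam * G x + 1/2 * (norm (x - w))\<^sup>2"
    using prox_objective_has_minimizer[OF lam] by blast
  have h_q: "\<not> h y < h q" for y
    using qmin[of y] by (cases "y \<in> D") (auto simp: h_in h_out q not_less)
  have p: "p = arg_min h (\<lambda>_. True)"
    by (simp add: p_def prox_def h_def[abs_def])
  have min: "\<forall>y. \<not> h y < h p"
    unfolding p by (rule arg_minI[where x = q]) (use h_q in auto)
  show mem: "p \<in> D"
    using min h_in[OF q] h_out by (metis less_ereal.simps(4))
  show "lam * G p + 1/2 * (norm (p - w))\<^sup>2 \<le> lam * G x + 1/2 * (norm (x - w))\<^sup>2" if "x \<in> D"
    using min[rule_format, of x] h_in[OF mem] h_in[OF that] by simp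
qed

text \<open>First-order optimality: compare \<open>p\<close> with the points of the segment towards
  \<open>x\<close>, divide by \<open>t\<close> and let \<open>t\<close> tend to 0 from the right.
  \<open>K\<close> is the coefficient of the second-order remainder.\<close>

lemma prox_variational:
  fixes w :: 'a
  assumes lam: "0 < lam" and x: "x \<in> D"
  defines "p \<equiv> prox (\<lambda>x. ereal lam * g x) w"
  shows "lam * (G p - G x) \<le> (p - w) \<bullet> (x - p)"
proof -
  have p: "p \<in> D" using prox_minimizes(1)[OF lam] by (simp add: p_def)
  define K where "K = (norm (x - p))\<^sup>2 / 2"
  have step: "lam * (G p - G x) \<le> (p - w) \<bullet> (x - p) + t * K" if t: "0 < t" "t \<le> 1" for t
  proof -
    define u where "u = (1 - t) *\<^sub>R p + t *\<^sub>R x"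
    have u: "u \<in> D" "G u \<le> (1 - t) * G p + t * G x"
      unfolding u_def using G_convex[OF p x, of t] t by auto
    have "u - w = (p - w) + t *\<^sub>R (x - p)" by (simp add: u_def algebra_simps)
    then have nu: "(norm (u - w))\<^sup>2 = (norm (p - w))\<^sup>2 + 2 * t * ((p - w) \<bullet> (x - p)) + t\<^sup>2 * (norm (x - p))\<^sup>2"
      by (simp only: power2_norm_eq_inner inner_add_left inner_add_right inner_scaleR_left
          inner_scaleR_right inner_commute[of "x - p" "p - w"]) (simp add: power2_eq_square distrib_left)
    have "lam * G p + 1/2 * (norm (p - w))\<^sup>2 \<le> lam * G u + 1/2 * (norm (u - w))\<^sup>2"
      using prox_minimizes(2)[OF lam u(1)] by (simp add: p_def)
    also have "lam * G u \<le> lam * ((1 - t) * G p + t * G x)" using u(2) lam by simp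
    finally have "t * (lam * (G p - G x)) \<le> t * ((p - w) \<bullet> (x - p) + t * K)"
      unfolding nu K_def by (simp add: power2_eq_square algebra_simps)
    then show ?thesis using t by simp
  qed
  have "((\<lambda>t. (p - w) \<bullet> (x - p) + t * K) \<longlongrightarrow> (p - w) \<bullet> (x - p) + 0 * K) (at_right 0)"
    by (intro tendsto_intros)
  moreover have "eventually (\<lambda>t. lam * (G p - G x) \<le> (p - w) \<bullet> (x - p) + t * K) (at_right (0::real))"
    by (rule eventually_at_rightI[of 0 1]) (use step in auto)
  ultimately have "lam * (G p - G x) \<le> (p - w) \<bullet> (x - p) + 0 * K"
    by (intro tendsto_lowerbound) auto
  then show ?thesis by simp
qed

text \<open>Test points outside \<open>D\<close> make the left-hand side infinite, so the inequality
  can be stated over the reals.\<close>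

lemma VI_solutions_iff:
  "zs \<in> VI_solutions F g \<longleftrightarrow> zs \<in> D \<and> (\<forall>x\<in>D. 0 \<le> F zs \<bullet> (x - zs) + G x - G zs)"
proof -
  have "ereal (F zs \<bullet> (x - zs)) + g x - g zs \<ge> 0 \<longleftrightarrow> (x \<in> D \<longrightarrow> 0 \<le> F zs \<bullet> (x - zs) + G x - G zs)"
    if "zs \<in> D" for x
    using that by (cases "x \<in> D") (auto simp: g_eq_G g_outside zero_ereal_def)
  then show ?thesis by (auto simp: VI_solutions_def)
qed

end

section \<open>The golden ratio algorithm\<close>

lemma golden_ratio_facts:
  fixes phi :: real
  assumes "phi = (sqrt 5 + 1) / 2"
  shows "1 < phi" and "phi * phi = phi + 1"
proof -
  have "1 < sqrt (5::real)" by simp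
  then show "1 < phi" unfolding assms by (simp only: less_divide_eq) simp
  have "sqrt 5 * sqrt 5 = 5" by simp
  then show "phi * phi = phi + 1" unfolding assms by (simp add: field_simps)
qed

text \<open>The golden ratio enters only through \<open>phi_gt\<close> and \<open>phi_sq\<close>.
  The recursion does not determine \<open>z 0\<close>.\<close>

locale golden_ratio_algorithm = proper_convex_lsc g
  for g :: "'a::real_inner \<Rightarrow> ereal" +
  fixes F :: "'a \<Rightarrow> 'a"
    and L lam phi :: real
    and z zbar :: "nat \<Rightarrow> 'a"
  assumes F_mono: "\<And>u v. u \<in> effective_domain g \<Longrightarrow> v \<in> effective_domain g \<Longrightarrow> (F u - F v) \<bullet> (u - v) \<ge> 0"
    and F_lipschitz: "L-lipschitz_on (effective_domain g) F"
    and phi_gt: "1 < phi" and phi_sq: "phi * phi = phi + 1"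
    and z1: "z 1 \<in> effective_domain g"
    and lam_pos: "0 < lam" and lam_L: "2 * lam * L \<le> phi"
    and zbar_step: "\<And>k. 1 \<le> k \<Longrightarrow> zbar k = ((phi - 1) *\<^sub>R z k + zbar (k - 1)) /\<^sub>R phi"
    and z_step: "\<And>k. 1 \<le> k \<Longrightarrow> z (k + 1) = prox (\<lambda>x. ereal lam * g x) (zbar k - lam *\<^sub>R F (z k))"
begin

section \<open>Relations between consecutive iterates\<close>

lemma z_in_domain: "1 \<le> k \<Longrightarrow> z k \<in> D"
proof (induction k rule: dec_induct)
  case base then show ?case using z1 by simp
next
  case (step k)
  then show ?case using z_step[of k] prox_minimizes(1)[OF lam_pos] by simp
qed

lemma step_variational:
  assumes "1 \<le> k" "x \<in> D"
  shows "lam * (G (z (k + 1)) - G x) \<le> (z (k + 1) - zbar k + lam *\<^sub>R F (z k)) \<bullet> (x - z (k + 1))"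
proof -
  have "z (k + 1) - (zbar k - lam *\<^sub>R F (z k)) = z (k + 1) - zbar k + lam *\<^sub>R F (z k)" by simp
  then show ?thesis
    using prox_variational[OF lam_pos assms(2), of "zbar k - lam *\<^sub>R F (z k)"]
    unfolding z_step[OF assms(1), symmetric] by metis
qed

text \<open>Used to express the variational inequality of \<open>z k\<close> through
  \<open>zbar k\<close>, which also occurs in that of \<open>z (k + 1)\<close>.\<close>

lemma z_minus_zbar_prev:
  assumes "1 \<le> k"
  shows "z k - zbar (k - 1) = phi *\<^sub>R (z k - zbar k)"
proof -
  have "phi *\<^sub>R zbar k = (phi - 1) *\<^sub>R z k + zbar (k - 1)"
    using zbar_step[OF assms] phi_gt by simp
  then show ?thesis by (simp add: algebra_simps)
qed

text \<open>The squared-norm identity for the convex combination \<open>zbar k\<close>, multiplied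
  by \<open>phi * phi = phi + 1\<close>.\<close>

lemma norm_zbar_step:
  assumes k: "1 \<le> k"
  shows "(1 + phi) * (norm (zbar k - x))\<^sup>2 =
    (norm (z k - x))\<^sup>2 + phi * (norm (zbar (k - 1) - x))\<^sup>2 - (phi - 1) * (norm (z k - zbar (k - 1)))\<^sup>2"
proof -
  define p where "p = z k - x"
  define q where "q = zbar (k - 1) - x"
  have "phi *\<^sub>R zbar k = (phi - 1) *\<^sub>R z k + zbar (k - 1)"
    using zbar_step[OF k] phi_gt by simp
  then have "phi *\<^sub>R (zbar k - x) = (phi - 1) *\<^sub>R p + q"
    by (simp add: p_def q_def algebra_simps)
  then have "(norm (phi *\<^sub>R (zbar k - x)))\<^sup>2 = (norm ((phi - 1) *\<^sub>R p + q))\<^sup>2" by simp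
  then have "phi * phi * (norm (zbar k - x))\<^sup>2 = (norm ((phi - 1) *\<^sub>R p + q))\<^sup>2"
    by (simp only: norm_scaleR power_mult_distrib power2_abs power2_eq_square[of phi])
  also have "\<dots> = (phi * phi - 2 * phi + 1) * (p \<bullet> p) + 2 * (phi - 1) * (p \<bullet> q) + q \<bullet> q"
    by (simp add: power2_norm_eq_inner inner_add_left inner_add_right inner_commute[of q p] algebra_simps)
  also have "\<dots> = p \<bullet> p + phi * (q \<bullet> q) - (phi - 1) * ((p - q) \<bullet> (p - q))"
    unfolding phi_sq by (simp add: inner_diff_left inner_diff_right inner_commute[of q p] algebra_simps)
  finally show ?thesis
    by (simp add: phi_sq p_def q_def power2_norm_eq_inner add.commute)
qed

section \<open>Descent of the energy\<close>

text \<open>The second term stores what pays for the Lipschitz error of the next step. At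
  \<open>k = 1\<close> it contains the undetermined \<open>z 0\<close>, so descent starts at
  \<open>k = 2\<close>.\<close>

definition energy :: "'a \<Rightarrow> nat \<Rightarrow> real" where
  "energy x k = (1 + phi) * (norm (zbar k - x))\<^sup>2 + phi / 2 * (norm (z k - z (k - 1)))\<^sup>2"

lemma energy_descent:
  assumes zs: "zs \<in> VI_solutions F g" and k: "2 \<le> k"
  shows "energy zs (k + 1) + phi * (norm (z k - zbar k))\<^sup>2 \<le> energy zs k"
proof -
  define u v w b where "u = z k" and "v = z (k - 1)" and "w = z (k + 1)" and "b = zbar k"
  have dom: "u \<in> D" "v \<in> D" "w \<in> D" "zs \<in> D"
    using k zs by (auto simp: u_def v_def w_def VI_solutions_iff intro!: z_in_domain)
  have 1: "lam * (G w - G zs) \<le> (w - b + lam *\<^sub>R F u) \<bullet> (zs - w)"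
    using step_variational[of k zs] k dom by (simp add: u_def w_def b_def)
  \<comment> \<open>The preceding step, tested at the new iterate; it exists because
    \<open>k - 1\<close> is at least 1.\<close>
  have "lam * (G u - G w) \<le> (u - zbar (k - 1) + lam *\<^sub>R F v) \<bullet> (w - u)"
    using step_variational[of "k - 1" w] k dom by (simp add: u_def v_def)
  then have 2: "lam * (G u - G w) \<le> (phi *\<^sub>R (u - b) + lam *\<^sub>R F v) \<bullet> (w - u)"
    using z_minus_zbar_prev[of k] k by (simp add: u_def b_def)
  \<comment> \<open>Monotonicity replaces \<open>F zs\<close> by \<open>F u\<close>, as in Minty's
    form of the inequality.\<close>
  have "0 \<le> F u \<bullet> (u - zs) + G u - G zs"
  proof -
    have "0 \<le> F zs \<bullet> (u - zs) + G u - G zs" using zs dom(1) by (auto simp: VI_solutions_iff)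
    moreover have "0 \<le> (F u - F zs) \<bullet> (u - zs)" using F_mono dom by blast
    ultimately show ?thesis by (simp add: inner_diff_left)
  qed
  then have 3: "0 \<le> lam * (F u \<bullet> (u - zs) + G u - G zs)" using lam_pos by simp
  \<comment> \<open>All values of \<open>G\<close> cancel, and the terms with \<open>F\<close>
    combine into a difference that the Lipschitz bound controls.\<close>
  have sum: "0 \<le> (w - b) \<bullet> (zs - w) + phi * ((u - b) \<bullet> (w - u)) + lam * ((F u - F v) \<bullet> (u - w))"
    using 1 2 3 by (simp add: inner_add_left inner_diff_left inner_diff_right algebra_simps)
  have id1: "2 * ((w - b) \<bullet> (zs - w)) = (norm (b - zs))\<^sup>2 - (norm (w - b))\<^sup>2 - (norm (w - zs))\<^sup>2"
    by (simp add: power2_norm_eq_inner inner_diff_left inner_diff_right inner_commute algebra_simps)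
  have id2: "2 * ((u - b) \<bullet> (w - u)) = (norm (w - b))\<^sup>2 - (norm (u - b))\<^sup>2 - (norm (w - u))\<^sup>2"
    by (simp add: power2_norm_eq_inner inner_diff_left inner_diff_right inner_commute algebra_simps)
  have id3: "(1 + phi) * (norm (zbar (k + 1) - zs))\<^sup>2 =
      (norm (w - zs))\<^sup>2 + phi * (norm (b - zs))\<^sup>2 - (phi - 1) * (norm (w - b))\<^sup>2"
    using norm_zbar_step[of "k + 1" zs] by (simp add: w_def b_def)
  \<comment> \<open>The step size bound enters here, after Cauchy-Schwarz and the Lipschitz
    estimate; the arithmetic-geometric mean inequality then splits the product.\<close>
  have lip: "2 * (lam * ((F u - F v) \<bullet> (u - w))) \<le> phi / 2 * ((norm (u - v))\<^sup>2 + (norm (w - u))\<^sup>2)"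
  proof -
    have "(F u - F v) \<bullet> (u - w) \<le> norm (F u - F v) * norm (w - u)"
      using norm_cauchy_schwarz[of "F u - F v" "u - w"] by (simp add: norm_minus_commute)
    also have "\<dots> \<le> L * norm (u - v) * norm (w - u)"
      using lipschitz_onD[OF F_lipschitz dom(1,2)] by (intro mult_right_mono) (auto simp: dist_norm)
    finally have "2 * lam * ((F u - F v) \<bullet> (u - w)) \<le> 2 * lam * (L * norm (u - v) * norm (w - u))"
      using lam_pos by simp
    also have "\<dots> = (2 * lam * L) * (norm (u - v) * norm (w - u))" by simp
    also have "\<dots> \<le> phi * (norm (u - v) * norm (w - u))"
      using lam_L by (intro mult_right_mono) auto
    also have "\<dots> \<le> phi * (((norm (u - v))\<^sup>2 + (norm (w - u))\<^sup>2) / 2)"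
      using sum_squares_bound[of "norm (u - v)" "norm (w - u)"] phi_gt by (intro mult_left_mono) auto
    finally show ?thesis by simp
  qed
  have "0 \<le> 2 * ((w - b) \<bullet> (zs - w)) + phi * (2 * ((u - b) \<bullet> (w - u))) + 2 * (lam * ((F u - F v) \<bullet> (u - w)))"
    using sum by simp
  \<comment> \<open>The squares of \<open>norm (w - b)\<close> have total coefficient
    \<open>phi - 1\<close>, exactly as \<open>id3\<close> requires. Half of
    \<open>phi * (norm (w - u))^2\<close> pays for \<open>lip\<close>, and the other half is the
    second term of the new energy.\<close>
  then have "0 \<le> (norm (b - zs))\<^sup>2 - (norm (w - b))\<^sup>2 - (norm (w - zs))\<^sup>2
      + phi * ((norm (w - b))\<^sup>2 - (norm (u - b))\<^sup>2 - (norm (w - u))\<^sup>2)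
      + phi / 2 * ((norm (u - v))\<^sup>2 + (norm (w - u))\<^sup>2)"
    unfolding id1 id2 using lip by linarith
  then show ?thesis
    using id3 by (simp add: energy_def u_def v_def w_def b_def algebra_simps)
qed

lemma energy_nonneg: "0 \<le> energy x k"
  unfolding energy_def using phi_gt by (intro add_nonneg_nonneg mult_nonneg_nonneg) auto

lemma energy_antimono:
  assumes "zs \<in> VI_solutions F g" "2 \<le> m" "m \<le> n"
  shows "energy zs n \<le> energy zs m"
  using assms(3,2)
proof (induction n rule: dec_induct)
  case base then show ?case by simp
next
  case (step n)
  have "energy zs (Suc n) + phi * (norm (z n - zbar n))\<^sup>2 \<le> energy zs n"
    using energy_descent[OF assms(1), of n] step by simp
  moreover have "0 \<le> phi * (norm (z n - zbar n))\<^sup>2" using phi_gt by simp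
  ultimately show ?case using step by linarith
qed

lemma dist_zbar_energy: "(norm (zbar k - x))\<^sup>2 \<le> energy x k"
proof -
  have "1 * (norm (zbar k - x))\<^sup>2 \<le> (1 + phi) * (norm (zbar k - x))\<^sup>2"
    using phi_gt by (intro mult_right_mono) auto
  moreover have "0 \<le> phi / 2 * (norm (z k - z (k - 1)))\<^sup>2" using phi_gt by simp
  ultimately show ?thesis unfolding energy_def by linarith
qed

section \<open>Limits of the iterates\<close>

text \<open>The energy is decreasing and nonnegative, so its decrements, which dominate these
  squared norms up to the factor \<open>phi\<close>, tend to 0.\<close>

lemma z_minus_zbar_tendsto:
  assumes zs: "zs \<in> VI_solutions F g"
  shows "(\<lambda>k. z k - zbar k) \<longlonglongrightarrow> 0"
proof -
  define e where "e n = energy zs (n + 2)" for n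
  have "decseq e" unfolding decseq_def e_def using energy_antimono[OF zs] by simp
  then obtain l where l: "e \<longlonglongrightarrow> l"
    by (rule decseq_convergent[of e 0]) (auto simp: e_def energy_nonneg)
  have "(\<lambda>n. (e n - e (Suc n)) / phi) \<longlonglongrightarrow> (l - l) / phi"
    using phi_gt by (intro tendsto_intros l LIMSEQ_Suc[OF l]) auto
  then have lim: "(\<lambda>n. (e n - e (Suc n)) / phi) \<longlonglongrightarrow> 0" by simp
  have "norm ((norm (z (n + 2) - zbar (n + 2)))\<^sup>2) \<le> (e n - e (Suc n)) / phi" for n
    using energy_descent[OF zs, of "n + 2"] phi_gt by (simp add: e_def field_simps)
  then have "(\<lambda>n. (norm (z (n + 2) - zbar (n + 2)))\<^sup>2) \<longlonglongrightarrow> 0"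
    by (intro Lim_null_comparison[OF always_eventually lim] allI)
  then have "(\<lambda>n. sqrt ((norm (z (n + 2) - zbar (n + 2)))\<^sup>2)) \<longlonglongrightarrow> sqrt 0"
    by (rule tendsto_real_sqrt)
  then have "(\<lambda>n. z (n + 2) - zbar (n + 2)) \<longlonglongrightarrow> 0"
    by (simp add: tendsto_norm_zero_iff)
  then show ?thesis by (rule LIMSEQ_offset)
qed

lemma z_Suc_minus_zbar_tendsto:
  assumes zs: "zs \<in> VI_solutions F g"
  shows "(\<lambda>k. z (Suc k) - zbar k) \<longlonglongrightarrow> 0"
proof -
  have "(\<lambda>k. phi *\<^sub>R (z (Suc k) - zbar (Suc k))) \<longlonglongrightarrow> phi *\<^sub>R 0"
    by (intro tendsto_intros LIMSEQ_Suc[OF z_minus_zbar_tendsto[OF zs]])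
  then show ?thesis using z_minus_zbar_prev[of "Suc _"] by simp
qed

text \<open>Passes to the limit in the variational inequality of \<open>z (Suc (r n))\<close>.
  Continuity of \<open>F\<close> is known only on \<open>D\<close>, so \<open>l \<in> D\<close> has
  to come first.\<close>

lemma cluster_point_solution:
  assumes zs: "zs \<in> VI_solutions F g"
    and r: "strict_mono r" and pos: "\<And>n. 1 \<le> r n" and l: "(\<lambda>n. zbar (r n)) \<longlonglongrightarrow> l"
  shows "l \<in> VI_solutions F g"
proof -
  have "(\<lambda>n. (z (r n) - zbar (r n)) + zbar (r n)) \<longlonglongrightarrow> 0 + l"
    using LIMSEQ_subseq_LIMSEQ[OF z_minus_zbar_tendsto[OF zs] r] l
    by (intro tendsto_add) (simp_all add: o_def)
  then have lz: "(\<lambda>n. z (r n)) \<longlonglongrightarrow> l" by simp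
  have d0: "(\<lambda>n. z (Suc (r n)) - zbar (r n)) \<longlonglongrightarrow> 0"
    using LIMSEQ_subseq_LIMSEQ[OF z_Suc_minus_zbar_tendsto[OF zs] r] by (simp add: o_def)
  from tendsto_add[OF this l] have lw: "(\<lambda>n. z (Suc (r n))) \<longlonglongrightarrow> l" by simp
  have in_D: "z (r n) \<in> D" "z (Suc (r n)) \<in> D" for n
    using pos[of n] by (auto intro: z_in_domain)
  define c where "c x n = G x + ((z (Suc (r n)) - zbar (r n)) \<bullet> (x - z (Suc (r n)))) / lam
      + F (z (r n)) \<bullet> (x - z (Suc (r n)))" for x n
  have G_le: "G (z (Suc (r n))) \<le> c x n" if "x \<in> D" for x n
  proof -
    have "lam * G (z (Suc (r n))) \<le> lam * c x n"
      using step_variational[OF pos that, of n] lam_pos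
      by (simp add: c_def inner_add_left distrib_left right_diff_distrib)
    then show ?thesis using lam_pos by simp
  qed
  \<comment> \<open>The limit \<open>F0\<close> stays a parameter, since \<open>F l\<close> is
    identified as the limit only once \<open>l \<in> D\<close> is known.\<close>
  have c_lim: "c x \<longlonglongrightarrow> G x + F0 \<bullet> (x - l)" if F0: "(\<lambda>n. F (z (r n))) \<longlonglongrightarrow> F0" for x F0
  proof -
    have "c x \<longlonglongrightarrow> G x + (0 \<bullet> (x - l)) / lam + F0 \<bullet> (x - l)"
      unfolding c_def[abs_def] using lam_pos by (intro tendsto_intros d0 lw F0) auto
    then show ?thesis by simp
  qed
  have l_dom: "l \<in> D"
  proof -
    have zs_D: "zs \<in> D" using zs by (simp add: VI_solutions_iff)
    \<comment> \<open>The Lipschitz bound around \<open>zs\<close> replaces the values of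
      \<open>F\<close>, so this upper bound converges whether or not \<open>F (z (r n))\<close>
      does.\<close>
    define c' where "c' n = G zs + ((z (Suc (r n)) - zbar (r n)) \<bullet> (zs - z (Suc (r n)))) / lam
      + (norm (F zs) + L * norm (z (r n) - zs)) * norm (zs - z (Suc (r n)))" for n
    have "G (z (Suc (r n))) \<le> c' n" for n
    proof -
      have "norm (F (z (r n)) - F zs) \<le> L * norm (z (r n) - zs)"
        using lipschitz_onD[OF F_lipschitz in_D(1) zs_D] by (simp add: dist_norm)
      then have "norm (F (z (r n))) \<le> norm (F zs) + L * norm (z (r n) - zs)"
        using norm_triangle_sub[of "F (z (r n))" "F zs"] by linarith
      then have "F (z (r n)) \<bullet> (zs - z (Suc (r n))) \<le>
          (norm (F zs) + L * norm (z (r n) - zs)) * norm (zs - z (Suc (r n)))"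
        by (meson norm_cauchy_schwarz mult_right_mono norm_ge_zero order_trans)
      then show ?thesis using G_le[OF zs_D, of n] by (simp add: c_def c'_def)
    qed
    moreover have "c' \<longlonglongrightarrow> G zs + (0 \<bullet> (zs - l)) / lam + (norm (F zs) + L * norm (l - zs)) * norm (zs - l)"
      unfolding c'_def[abs_def] using lam_pos by (intro tendsto_intros d0 lw lz) auto
    ultimately show ?thesis using G_lsc(1)[OF lw in_D(2)] by blast
  qed
  have "(\<lambda>n. F (z (r n))) \<longlonglongrightarrow> F l"
    using continuous_on_tendsto_compose[OF lipschitz_on_continuous_on[OF F_lipschitz] lz l_dom] in_D
    by simp
  from G_lsc(2)[OF lw in_D(2) G_le c_lim[OF this]]
  have "G l \<le> G x + F l \<bullet> (x - l)" if "x \<in> D" for x using that by blast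
  then show ?thesis using l_dom by (force simp: VI_solutions_iff)
qed

text \<open>A Fejer-type argument: the cluster point \<open>l\<close> is itself a solution, so the
  energy relative to \<open>l\<close> decreases and a subsequence tending to 0 forces the whole
  sequence to 0.\<close>

lemma iterates_converge:
  assumes "VI_solutions F g \<noteq> {}"
  shows "\<exists>zs \<in> VI_solutions F g. z \<longlonglongrightarrow> zs \<and> zbar \<longlonglongrightarrow> zs"
proof -
  obtain zs where zs: "zs \<in> VI_solutions F g" using assms by blast
  have "norm (zbar (n + 2)) \<le> norm zs + sqrt (energy zs 2)" for n
  proof -
    have "(norm (zbar (n + 2) - zs))\<^sup>2 \<le> energy zs 2"
      using dist_zbar_energy[of "n + 2" zs] energy_antimono[OF zs, of 2 "n + 2"] by simp
    then have "norm (zbar (n + 2) - zs) \<le> sqrt (energy zs 2)" by (rule real_le_rsqrt)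
    then show ?thesis using norm_triangle_sub[of "zbar (n + 2)" zs] by linarith
  qed
  then have "bounded (range (\<lambda>n. zbar (n + 2)))" by (auto simp: bounded_iff)
  then obtain l s where s: "strict_mono s" and l: "(\<lambda>n. zbar (s n + 2)) \<longlonglongrightarrow> l"
    using bounded_convergent_subseq_finite_span[OF fin_dim] by blast
  \<comment> \<open>The shift by 2 keeps all indices in the range where the energy
    decreases.\<close>
  define r where "r n = s n + 2" for n
  have r: "strict_mono r" using s by (simp add: r_def strict_mono_def)
  have l': "(\<lambda>n. zbar (r n)) \<longlonglongrightarrow> l" using l by (simp add: r_def)
  have sol: "l \<in> VI_solutions F g"
    by (rule cluster_point_solution[OF zs r _ l']) (simp add: r_def)
  \<comment> \<open>Makes the second term of the energy vanish along \<open>r\<close>; the first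
    vanishes since \<open>zbar (r n)\<close> tends to \<open>l\<close>.\<close>
  have "(\<lambda>n. z n - z (n - 1)) \<longlonglongrightarrow> 0"
  proof -
    have "(\<lambda>n. (z (Suc n) - zbar n) - (z n - zbar n)) \<longlonglongrightarrow> 0 - 0"
      by (intro tendsto_diff z_Suc_minus_zbar_tendsto[OF zs] z_minus_zbar_tendsto[OF zs])
    then have "(\<lambda>n. z (Suc n) - z (Suc n - 1)) \<longlonglongrightarrow> 0" by simp
    then show ?thesis by (rule LIMSEQ_imp_Suc)
  qed
  then have dz: "(\<lambda>n. z (r n) - z (r n - 1)) \<longlonglongrightarrow> 0"
    using LIMSEQ_subseq_LIMSEQ[OF _ r] unfolding o_def by blast
  have "(\<lambda>n. energy l (r n)) \<longlonglongrightarrow> (1 + phi) * (norm (l - l))\<^sup>2 + phi / 2 * (norm (0::'a))\<^sup>2"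
    unfolding energy_def by (intro tendsto_intros l' dz)
  then have e0: "(\<lambda>n. energy l (r n)) \<longlonglongrightarrow> 0" by simp
  have zbar_lim: "zbar \<longlonglongrightarrow> l"
  proof (rule LIMSEQ_I)
    fix \<epsilon> :: real assume \<epsilon>: "0 < \<epsilon>"
    then have "eventually (\<lambda>n. energy l (r n) < \<epsilon>\<^sup>2) sequentially"
      using e0 by (intro order_tendstoD) auto
    then obtain n where n: "energy l (r n) < \<epsilon>\<^sup>2" by (auto simp: eventually_sequentially)
    \<comment> \<open>A single index with small energy controls all later ones by
      monotonicity.\<close>
    have "norm (zbar k - l) < \<epsilon>" if "r n \<le> k" for k
    proof -
      have "(norm (zbar k - l))\<^sup>2 < \<epsilon>\<^sup>2"
        using dist_zbar_energy[of k l] energy_antimono[OF sol _ that] n by (force simp: r_def)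
      then show ?thesis using \<epsilon> by (simp add: power2_less_imp_less)
    qed
    then show "\<exists>no. \<forall>k\<ge>no. norm (zbar k - l) < \<epsilon>" by blast
  qed
  have "z \<longlonglongrightarrow> l"
    using tendsto_add[OF z_minus_zbar_tendsto[OF zs] zbar_lim] by simp
  then show ?thesis using sol zbar_lim by blast
qed

end

theorem theorem1:
  fixes g :: "'a::real_inner \<Rightarrow> ereal"
    and F :: "'a \<Rightarrow> 'a"
    and L lam phi :: real
    and z zbar :: "nat \<Rightarrow> 'a"
  assumes fin_dim: "\<exists>B::'a set. finite B \<and> span B = UNIV"
    and g_proper: "proper_fun g"
    and g_convex: "convex_fun g"
    and g_lsc: "lower_semicontinuous g"
    and F_mono: "\<forall>u\<in>effective_domain g. \<forall>v\<in>effective_domain g. (F u - F v) \<bullet> (u - v) \<ge> 0"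
    and L_pos: "L > 0"
    and F_lipschitz: "L-lipschitz_on (effective_domain g) F"
    and solvable: "VI_solutions F g \<noteq> {}"
    and phi: "phi = (sqrt 5 + 1) / 2"
    and z1: "z 1 \<in> effective_domain g"
    and lam: "lam \<in> {0<..phi / (2 * L)}"
    and zbar_step: "\<forall>k\<ge>1. zbar k = ((phi - 1) *\<^sub>R z k + zbar (k - 1)) /\<^sub>R phi"
    and z_step: "\<forall>k\<ge>1. z (k + 1) = prox (\<lambda>x. ereal lam * g x) (zbar k - lam *\<^sub>R F (z k))"
  shows "\<exists>zs \<in> VI_solutions F g. z \<longlonglongrightarrow> zs \<and> zbar \<longlonglongrightarrow> zs"
proof -
  have "lam * L \<le> phi / 2"
    using lam L_pos by (simp add: field_simps)
  then interpret golden_ratio_algorithm g F L lam phi z zbar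
    using assms golden_ratio_facts[OF phi]
    by unfold_locales auto
  show ?thesis using solvable by (rule iterates_converge)
qed

end
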